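(* Let $\alpha,\beta\in\mathbb{C}$ be nonzero with $|\alpha|^2+|\beta|^2=1$. Then the operator $S_{\alpha,\beta}$ on $H^2_{\alpha,\beta}$ is a shift, i.e. it is unitarily equivalent to the operator $M_z$ of multiplication by the coordinate function $z$ on some analytic reproducing kernel Hilbert space $\mathcal{H}_k$.
   Context: $H^2(\mathbb{D})$ is the Hardy space of the open unit disc $\mathbb{D}$. Put $f_0=\alpha+\beta z$ and let $H^2_{\alpha,\beta}=\overline{\mathrm{span}}\{f_0,\ z^n: n\ge 2\}$, a closed subspace of $H^2(\mathbb{D})$. Let $P_{H^2_{\alpha,\beta}}$ be the orthogonal projection of $H^2(\mathbb{D})$ onto $H^2_{\alpha,\beta}$ and $M_z$ multiplication by $z$ on $H^2(\mathbb{D})$. The operator $S_{\alpha,\beta}:H^2_{\alpha,\beta}\to H^2_{\alpha,\beta}$ is $S_{\alpha,\beta}=P_{H^2_{\alpha,\beta}}M_z|_{H^2_{\alpha,\beta}}$. An analytic reproducing kernel Hilbert space is a Hilbert space of analytic functions on some domain in $\mathbb{C}$ on which all point evaluations are bounded; $M_z$ on it is required to be a well-defined bounded operator. *)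

theory Defs
  imports "HOL-Complex_Analysis.Complex_Analysis" "HOL-Library.Function_Algebras"
begin

text \<open>
  A complex-valued function on a domain \<open>\<Omega>\<close> is represented by its extension by zero to all of
  \<open>\<complex>\<close>, so that functions on \<open>\<Omega>\<close> correspond one-to-one to representatives and the
  vector space operations are the pointwise ones.
\<close>

type_synonym cfun = "complex \<Rightarrow> complex"

definition zero_ext :: "complex set \<Rightarrow> cfun \<Rightarrow> cfun" where
  "zero_ext \<Omega> f = (\<lambda>z. if z \<in> \<Omega> then f z else 0)"

definition analytic_functions :: "complex set \<Rightarrow> cfun set" where
  "analytic_functions \<Omega> = {f. f analytic_on \<Omega> \<and> (\<forall>z. z \<notin> \<Omega> \<longrightarrow> f z = 0)}"

definition cscale :: "complex \<Rightarrow> cfun \<Rightarrow> cfun" where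
  "cscale c f = (\<lambda>z. c * f z)"

interpretation cfun: vector_space cscale
  by unfold_locales (auto simp: cscale_def fun_eq_iff algebra_simps)


subsection \<open>Complex Hilbert spaces of functions\<close>

text \<open>
  Such a space is a carrier \<open>V\<close> with an inner product \<open>ip\<close>, linear in its
  first argument; the values of \<open>ip\<close> outside \<open>V\<close> are irrelevant.
\<close>

definition hnorm :: "(cfun \<Rightarrow> cfun \<Rightarrow> complex) \<Rightarrow> cfun \<Rightarrow> real" where
  "hnorm ip f = sqrt (Re (ip f f))"

text \<open>
  The value off \<open>V\<close> is fixed to be 0 because the locale \<open>Metric_space\<close> requires the
  distance to be symmetric and nonnegative on the whole type.
\<close>

definition hdist :: "cfun set \<Rightarrow> (cfun \<Rightarrow> cfun \<Rightarrow> complex) \<Rightarrow> cfun \<Rightarrow> cfun \<Rightarrow> real" where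
  "hdist V ip f g = (if f \<in> V \<and> g \<in> V then hnorm ip (f - g) else 0)"

definition inner_product_on :: "cfun set \<Rightarrow> (cfun \<Rightarrow> cfun \<Rightarrow> complex) \<Rightarrow> bool" where
  "inner_product_on V ip \<longleftrightarrow>
     (\<forall>f\<in>V. \<forall>g\<in>V. \<forall>h\<in>V. ip (f + g) h = ip f h + ip g h) \<and>
     (\<forall>c. \<forall>f\<in>V. \<forall>g\<in>V. ip (cscale c f) g = c * ip f g) \<and>
     (\<forall>f\<in>V. \<forall>g\<in>V. ip g f = cnj (ip f g)) \<and>
     (\<forall>f\<in>V. 0 \<le> Re (ip f f)) \<and>
     (\<forall>f\<in>V. ip f f = 0 \<longrightarrow> f = 0)"

definition hilbert_space_on :: "cfun set \<Rightarrow> (cfun \<Rightarrow> cfun \<Rightarrow> complex) \<Rightarrow> bool" where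
  "hilbert_space_on V ip \<longleftrightarrow>
     cfun.subspace V \<and> inner_product_on V ip \<and> Metric_space.mcomplete V (hdist V ip)"

definition linear_map_on :: "cfun set \<Rightarrow> (cfun \<Rightarrow> cfun) \<Rightarrow> bool" where
  "linear_map_on V T \<longleftrightarrow>
     (\<forall>f\<in>V. \<forall>g\<in>V. T (f + g) = T f + T g) \<and>
     (\<forall>c. \<forall>f\<in>V. T (cscale c f) = cscale c (T f))"

definition bounded_operator_on ::
    "cfun set \<Rightarrow> (cfun \<Rightarrow> cfun \<Rightarrow> complex) \<Rightarrow> (cfun \<Rightarrow> cfun) \<Rightarrow> bool" where
  "bounded_operator_on V ip T \<longleftrightarrow>
     T \<in> V \<rightarrow> V \<and> linear_map_on V T \<and> (\<exists>C. \<forall>f\<in>V. hnorm ip (T f) \<le> C * hnorm ip f)"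

definition orth_proj ::
    "(cfun \<Rightarrow> cfun \<Rightarrow> complex) \<Rightarrow> cfun set \<Rightarrow> cfun \<Rightarrow> cfun" where
  "orth_proj ip M f = (THE g. g \<in> M \<and> (\<forall>h\<in>M. ip (f - g) h = 0))"

definition unitary_between ::
    "cfun set \<Rightarrow> (cfun \<Rightarrow> cfun \<Rightarrow> complex) \<Rightarrow> cfun set \<Rightarrow> (cfun \<Rightarrow> cfun \<Rightarrow> complex)
      \<Rightarrow> (cfun \<Rightarrow> cfun) \<Rightarrow> bool" where
  "unitary_between V ip W jp U \<longleftrightarrow>
     bij_betw U V W \<and> linear_map_on V U \<and> (\<forall>f\<in>V. \<forall>g\<in>V. jp (U f) (U g) = ip f g)"

definition unitarily_equivalent ::
    "cfun set \<Rightarrow> (cfun \<Rightarrow> cfun \<Rightarrow> complex) \<Rightarrow> (cfun \<Rightarrow> cfun)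
      \<Rightarrow> cfun set \<Rightarrow> (cfun \<Rightarrow> cfun \<Rightarrow> complex) \<Rightarrow> (cfun \<Rightarrow> cfun) \<Rightarrow> bool" where
  "unitarily_equivalent V ip S W jp T \<longleftrightarrow>
     S \<in> V \<rightarrow> V \<and> T \<in> W \<rightarrow> W \<and>
     (\<exists>U. unitary_between V ip W jp U \<and> (\<forall>f\<in>V. U (S f) = T (U f)))"


subsection \<open>Analytic reproducing kernel Hilbert spaces and shifts\<close>

definition analytic_rkhs ::
    "complex set \<Rightarrow> cfun set \<Rightarrow> (cfun \<Rightarrow> cfun \<Rightarrow> complex) \<Rightarrow> bool" where
  "analytic_rkhs \<Omega> H ip \<longleftrightarrow>
     open \<Omega> \<and> connected \<Omega> \<and> \<Omega> \<noteq> {} \<and>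
     H \<subseteq> analytic_functions \<Omega> \<and> hilbert_space_on H ip \<and>
     (\<forall>w\<in>\<Omega>. \<exists>C. \<forall>f\<in>H. cmod (f w) \<le> C * hnorm ip f)"

definition Mz :: "cfun \<Rightarrow> cfun" where
  "Mz f = (\<lambda>z. z * f z)"

definition is_shift ::
    "cfun set \<Rightarrow> (cfun \<Rightarrow> cfun \<Rightarrow> complex) \<Rightarrow> (cfun \<Rightarrow> cfun) \<Rightarrow> bool" where
  "is_shift V ip S \<longleftrightarrow>
     (\<exists>\<Omega> H jp. analytic_rkhs \<Omega> H jp \<and> bounded_operator_on H jp Mz \<and>
        unitarily_equivalent V ip S H jp Mz)"


subsection \<open>The Hardy space of the disc and the operator \<open>S\<^sub>\<alpha>\<^sub>,\<^sub>\<beta>\<close>\<close>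

abbreviation unit_disc :: "complex set" where
  "unit_disc \<equiv> ball 0 1"

definition taylor_coeff :: "cfun \<Rightarrow> nat \<Rightarrow> complex" where
  "taylor_coeff f n = (deriv ^^ n) f 0 / fact n"

definition H2 :: "cfun set" where
  "H2 = {f \<in> analytic_functions unit_disc. summable (\<lambda>n. (cmod (taylor_coeff f n))\<^sup>2)}"

definition H2_ip :: "cfun \<Rightarrow> cfun \<Rightarrow> complex" where
  "H2_ip f g = (\<Sum>n. taylor_coeff f n * cnj (taylor_coeff g n))"

definition H2_ab :: "complex \<Rightarrow> complex \<Rightarrow> cfun set" where
  "H2_ab \<alpha> \<beta> =
     Metric_space.mtopology H2 (hdist H2 H2_ip) closure_of
       cfun.span (insert (zero_ext unit_disc (\<lambda>z. \<alpha> + \<beta> * z))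
                         {zero_ext unit_disc (\<lambda>z. z ^ n) | n. n \<ge> 2})"

definition S_ab :: "complex \<Rightarrow> complex \<Rightarrow> cfun \<Rightarrow> cfun" where
  "S_ab \<alpha> \<beta> f = orth_proj H2_ip (H2_ab \<alpha> \<beta>) (Mz f)"

end

theory Submission
  imports Defs
begin

text \<open>
  Since \<open>|\<alpha>|\<^sup>2 + |\<beta>|\<^sup>2 = 1\<close>, the functions \<open>e\<^sub>0 = \<alpha> + \<beta>z\<close> and \<open>e\<^sub>n = z\<^sup>n\<^sup>+\<^sup>1\<close> for \<open>n \<ge> 1\<close> form an
  orthonormal basis of the space, on which the operator \<open>S = S\<^sub>\<alpha>\<^sub>,\<^sub>\<beta>\<close> acts by
  \<open>S e\<^sub>0 = a e\<^sub>0 + \<beta> e\<^sub>1\<close>, with \<open>a = \<alpha> cnj \<beta>\<close>, and \<open>S e\<^sub>n = e\<^sub>n\<^sub>+\<^sub>1\<close> for \<open>n \<ge> 1\<close>. For each \<open>w\<close> in the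
  disc the equation \<open>S\<^sup>* k = cnj w k\<close> can be solved with first coordinate 1, and the pairing
  with the solution \<open>k\<^sub>w\<close> is
  \<open>(U f)(w) = \<langle>f, k\<^sub>w\<rangle> = f\<^sub>0/\<alpha> + ((w - a)/\<beta>) (\<Sum>n. f\<^sub>n\<^sub>+\<^sub>2 w\<^sup>n)\<close>,
  where \<open>f\<^sub>n\<close> are the Taylor coefficients of \<open>f\<close>. Because \<open>k\<^sub>w\<close> is an eigenvector of the adjoint,
  \<open>U\<close> turns \<open>S\<close> into multiplication by the coordinate function (\<open>shift_model_intertwines\<close>).
  Square summability of the \<open>f\<^sub>n\<close> makes \<open>U f\<close> analytic on the disc, with bounded point evaluations.

  The map \<open>U\<close> is injective (\<open>inj_on_shift_model\<close>): \<open>|a| \<le> 1/2\<close>, so the point \<open>a\<close> lies in the disc and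
  the value of \<open>U f\<close> there determines \<open>f\<^sub>0\<close>, after which the remaining factor determines all
  \<open>f\<^sub>n\<close> with \<open>n \<ge> 2\<close>; finally \<open>f\<^sub>1\<close> is tied to \<open>f\<^sub>0\<close>. Hence the range of \<open>U\<close> with the inner product
  transported from the given space is an analytic reproducing kernel Hilbert space on which
  multiplication by the coordinate is unitarily equivalent to \<open>S\<close> (\<open>is_shiftI\<close>).

  To make this concrete, the space is identified as the set of \<open>f\<close> in the Hardy space with
  \<open>\<beta> f\<^sub>0 = \<alpha> f\<^sub>1\<close> (\<open>H2_ab_eq\<close>); its orthogonal complement is spanned by the unit vector
  \<open>cnj \<beta> - cnj \<alpha> z\<close>, which yields the Taylor coefficients of \<open>S f\<close> (\<open>taylor_coeff_S_ab\<close>).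
\<close>

section \<open>Inner product spaces of functions\<close>

locale inner_product_subspace =
  fixes V :: "cfun set" and ip :: "cfun \<Rightarrow> cfun \<Rightarrow> complex"
  assumes linear_subspace: "cfun.subspace V" and inner_product: "inner_product_on V ip"
begin

lemma ip_add_left: "f \<in> V \<Longrightarrow> g \<in> V \<Longrightarrow> h \<in> V \<Longrightarrow> ip (f + g) h = ip f h + ip g h"
  and ip_scale_left: "f \<in> V \<Longrightarrow> g \<in> V \<Longrightarrow> ip (cscale c f) g = c * ip f g"
  and ip_commute: "f \<in> V \<Longrightarrow> g \<in> V \<Longrightarrow> ip g f = cnj (ip f g)"
  and ip_nonneg: "f \<in> V \<Longrightarrow> 0 \<le> Re (ip f f)"
  and ip_definite: "f \<in> V \<Longrightarrow> ip f f = 0 \<Longrightarrow> f = 0"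
  using inner_product unfolding inner_product_on_def by metis+

lemma add_mem: "f \<in> V \<Longrightarrow> g \<in> V \<Longrightarrow> f + g \<in> V"
  and scale_mem: "f \<in> V \<Longrightarrow> cscale c f \<in> V"
  and diff_mem: "f \<in> V \<Longrightarrow> g \<in> V \<Longrightarrow> f - g \<in> V"
  and zero_mem: "0 \<in> V"
  using linear_subspace cfun.subspace_add cfun.subspace_scale cfun.subspace_diff cfun.subspace_0 by blast+

lemma diff_eq_add_scale: "(f::cfun) - g = f + cscale (-1) g"
  by (simp add: cscale_def fun_eq_iff)

lemma ip_diff_left: "f \<in> V \<Longrightarrow> g \<in> V \<Longrightarrow> h \<in> V \<Longrightarrow> ip (f - g) h = ip f h - ip g h"
  by (simp only: diff_eq_add_scale ip_add_left ip_scale_left scale_mem) simp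

lemma ip_diff_right:
  assumes "f \<in> V" "g \<in> V" "h \<in> V"
  shows "ip h (f - g) = ip h f - ip h g"
  using assms ip_commute[of "f - g" h] ip_commute[of f h] ip_commute[of g h]
  by (simp add: ip_diff_left diff_mem)

lemma ip_scale_right:
  assumes "f \<in> V" "g \<in> V"
  shows "ip g (cscale c f) = cnj c * ip g f"
  using assms ip_commute[of "cscale c f" g] ip_commute[of f g]
  by (simp add: ip_scale_left scale_mem)

lemma ip_zero_left: "h \<in> V \<Longrightarrow> ip 0 h = 0"
  using ip_add_left[of 0 0 h] zero_mem by simp

lemma hnorm_nonneg: "f \<in> V \<Longrightarrow> 0 \<le> hnorm ip f"
  by (simp add: hnorm_def ip_nonneg)

lemma hnorm_square: "f \<in> V \<Longrightarrow> (hnorm ip f)\<^sup>2 = Re (ip f f)"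
  by (simp add: hnorm_def ip_nonneg)

lemma ip_self: "f \<in> V \<Longrightarrow> ip f f = of_real ((hnorm ip f)\<^sup>2)"
  using ip_commute[of f f] by (simp add: hnorm_square complex_eq_iff)

lemma hnorm_eq_0_iff: "f \<in> V \<Longrightarrow> hnorm ip f = 0 \<longleftrightarrow> f = 0"
  using ip_self[of f] ip_definite[of f] ip_zero_left[of 0] zero_mem
  by (auto simp: hnorm_def)

lemma Re_ip_diff_self:
  assumes "f \<in> V" "g \<in> V"
  shows "(hnorm ip (f - g))\<^sup>2 = (hnorm ip f)\<^sup>2 + (hnorm ip g)\<^sup>2 - 2 * Re (ip f g)"
  using assms ip_commute[of f g]
  by (simp add: hnorm_square diff_mem ip_diff_left ip_diff_right)

text \<open>
  The vector \<open>\<parallel>g\<parallel> f - \<parallel>f\<parallel> g\<close> has nonnegative norm; expanding its square gives the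
  Cauchy--Schwarz inequality for real parts, which is all that the triangle inequality needs.
\<close>

lemma Re_ip_le:
  assumes "f \<in> V" "g \<in> V"
  shows "Re (ip f g) \<le> hnorm ip f * hnorm ip g"
proof (cases "f = 0 \<or> g = 0")
  case True
  then have "ip f g = 0" 
    using ip_zero_left assms ip_commute[of g f] by auto
  then show ?thesis
    using assms by (simp add: hnorm_nonneg)
next
  case False
  define a b where "a = hnorm ip f" and "b = hnorm ip g"
  have pos: "a > 0" "b > 0"
    using False assms hnorm_nonneg hnorm_eq_0_iff by (auto simp: a_def b_def less_le)
  have "Re (ip f f) = a\<^sup>2" "Re (ip g g) = b\<^sup>2"
    using assms by (simp_all add: a_def b_def hnorm_square)
  then have "0 \<le> b * (b * a\<^sup>2) + a * (a * b\<^sup>2) - 2 * (a * b * Re (ip f g))"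
    using zero_le_power2[of "hnorm ip (cscale (of_real b) f - cscale (of_real a) g)"] assms
    by (subst (asm) Re_ip_diff_self)
      (simp_all add: scale_mem hnorm_square ip_scale_left ip_scale_right algebra_simps)
  then have "(a * b) * Re (ip f g) \<le> (a * b) * (a * b)"
    by (simp add: power2_eq_square algebra_simps)
  then show ?thesis
    using pos by (simp flip: a_def b_def)
qed

lemma hnorm_minus_commute:
  assumes "f \<in> V" "g \<in> V"
  shows "hnorm ip (f - g) = hnorm ip (g - f)"
  using assms by (simp add: hnorm_def ip_diff_left ip_diff_right diff_mem)

lemma hnorm_triangle:
  assumes "f \<in> V" "g \<in> V" "h \<in> V"
  shows "hnorm ip (f - h) \<le> hnorm ip (f - g) + hnorm ip (g - h)"
proof (rule power2_le_imp_le)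
  have mem: "f - g \<in> V" "h - g \<in> V"
    using assms diff_mem by blast+
  have neg: "- Re (ip (f - g) (h - g)) = Re (ip (f - g) (g - h))"
    using assms by (simp add: ip_diff_right diff_mem)
  have "(hnorm ip (f - h))\<^sup>2 = (hnorm ip ((f - g) - (h - g)))\<^sup>2"
    by simp
  also have "\<dots> = (hnorm ip (f - g))\<^sup>2 + (hnorm ip (h - g))\<^sup>2 - 2 * Re (ip (f - g) (h - g))"
    using mem by (rule Re_ip_diff_self)
  also have "(hnorm ip (f - g))\<^sup>2 + (hnorm ip (h - g))\<^sup>2 - 2 * Re (ip (f - g) (h - g))
      \<le> (hnorm ip (f - g))\<^sup>2 + (hnorm ip (g - h))\<^sup>2 + 2 * (hnorm ip (f - g) * hnorm ip (g - h))"
    using Re_ip_le[of "f - g" "g - h"] hnorm_minus_commute[of g h] assms neg by (simp add: diff_mem)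
  also have "\<dots> = (hnorm ip (f - g) + hnorm ip (g - h))\<^sup>2"
    by (simp add: power2_sum)
  finally show "(hnorm ip (f - h))\<^sup>2 \<le> (hnorm ip (f - g) + hnorm ip (g - h))\<^sup>2" .
  show "0 \<le> hnorm ip (f - g) + hnorm ip (g - h)"
    using assms by (simp add: hnorm_nonneg diff_mem)
qed

sublocale Metric_space V "hdist V ip"
proof
  show "0 \<le> hdist V ip f g" for f g
    by (simp add: hdist_def hnorm_nonneg diff_mem)
  show "hdist V ip f g = hdist V ip g f" for f g
    by (simp add: hdist_def hnorm_minus_commute)
  show "hdist V ip f g = 0 \<longleftrightarrow> f = g" if "f \<in> V" "g \<in> V" for f g
    using that by (simp add: hdist_def hnorm_eq_0_iff diff_mem)
  show "hdist V ip f h \<le> hdist V ip f g + hdist V ip g h"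
    if "f \<in> V" "g \<in> V" "h \<in> V" for f g h
    using that by (simp add: hdist_def hnorm_triangle)
qed

text \<open>
  Stated with norms of differences instead of distances, so that completeness can be carried
  between carriers, on which the distance \<^const>\<open>hdist\<close> depends.
\<close>

lemma mcomplete_iff:
  "mcomplete \<longleftrightarrow>
     (\<forall>\<sigma> :: nat \<Rightarrow> cfun. (\<forall>n. \<sigma> n \<in> V) \<and>
          (\<forall>\<epsilon>>0. \<exists>N. \<forall>m\<ge>N. \<forall>n\<ge>N. hnorm ip (\<sigma> m - \<sigma> n) < \<epsilon>) \<longrightarrow>
        (\<exists>f\<in>V. \<forall>\<epsilon>>0. \<exists>N. \<forall>n\<ge>N. hnorm ip (\<sigma> n - f) < \<epsilon>))"
proof -
  have cauchy: "MCauchy \<sigma> \<longleftrightarrow>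
      (\<forall>n. \<sigma> n \<in> V) \<and> (\<forall>\<epsilon>>0. \<exists>N. \<forall>m\<ge>N. \<forall>n\<ge>N. hnorm ip (\<sigma> m - \<sigma> n) < \<epsilon>)" for \<sigma>
    unfolding MCauchy_def hdist_def by (auto simp: image_subset_iff)
  have limit: "limitin mtopology \<sigma> f sequentially \<longleftrightarrow>
      f \<in> V \<and> (\<forall>\<epsilon>>0. \<exists>N. \<forall>n\<ge>N. hnorm ip (\<sigma> n - f) < \<epsilon>)" if "\<forall>n. \<sigma> n \<in> V" for \<sigma> f
    unfolding limit_metric_sequentially hdist_def using that by auto
  have iff: "(MCauchy \<sigma> \<longrightarrow> (\<exists>f. limitin mtopology \<sigma> f sequentially)) \<longleftrightarrow>
      ((\<forall>n. \<sigma> n \<in> V) \<and> (\<forall>\<epsilon>>0. \<exists>N. \<forall>m\<ge>N. \<forall>n\<ge>N. hnorm ip (\<sigma> m - \<sigma> n) < \<epsilon>) \<longrightarrow>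
        (\<exists>f\<in>V. \<forall>\<epsilon>>0. \<exists>N. \<forall>n\<ge>N. hnorm ip (\<sigma> n - f) < \<epsilon>))" for \<sigma>
    by (cases "\<forall>n. \<sigma> n \<in> V") (simp_all only: cauchy limit simp_thms Bex_def)
  show ?thesis
    unfolding mcomplete_def by (intro all_cong1 iff)
qed

text \<open>
  A vector of a subspace that is orthogonal to that subspace vanishes, so the definite description
  in \<^const>\<open>orth_proj\<close> is determined by any candidate.
\<close>

lemma orth_proj_eqI:
  assumes M: "cfun.subspace M" "M \<subseteq> V" and f: "f \<in> V"
    and g: "g \<in> M" "\<And>h. h \<in> M \<Longrightarrow> ip (f - g) h = 0"
  shows "orth_proj ip M f = g"
  unfolding orth_proj_def
proof (rule the_equality)
  fix g' assume g': "g' \<in> M \<and> (\<forall>h\<in>M. ip (f - g') h = 0)"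
  have d: "g' - g \<in> M"
    using cfun.subspace_diff M(1) g g' by blast
  have "ip (g' - g) (g' - g) = ip ((f - g) - (f - g')) (g' - g)"
    by simp
  also have "\<dots> = ip (f - g) (g' - g) - ip (f - g') (g' - g)"
    using M f g g' d by (intro ip_diff_left diff_mem) auto
  also have "\<dots> = 0"
    using g g' d by simp
  finally show "g' = g"
    using ip_definite[of "g' - g"] d M by auto
qed (use g in blast)

end


section \<open>Unitary transport and a criterion for being a shift\<close>

text \<open>The inner product on \<open>U ` V\<close> that makes an injective \<open>U\<close> unitary.\<close>

definition transported_ip ::
    "cfun set \<Rightarrow> (cfun \<Rightarrow> cfun \<Rightarrow> complex) \<Rightarrow> (cfun \<Rightarrow> cfun) \<Rightarrow> cfun \<Rightarrow> cfun \<Rightarrow> complex" where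
  "transported_ip V ip U f g = ip (inv_into V U f) (inv_into V U g)"

locale injective_image = inner_product_subspace +
  fixes U :: "cfun \<Rightarrow> cfun"
  assumes linear: "linear_map_on V U" and inj: "inj_on U V"
begin

abbreviation "jp \<equiv> transported_ip V ip U"

lemma U_add: "f \<in> V \<Longrightarrow> g \<in> V \<Longrightarrow> U (f + g) = U f + U g"
  and U_scale: "f \<in> V \<Longrightarrow> U (cscale c f) = cscale c (U f)"
  using linear unfolding linear_map_on_def by blast+

lemma U_diff: "f \<in> V \<Longrightarrow> g \<in> V \<Longrightarrow> U (f - g) = U f - U g"
  by (simp only: diff_eq_add_scale U_add U_scale scale_mem)

lemma U_zero: "U 0 = 0"
  using U_diff[of 0 0] zero_mem by simp

lemma jp_U: "f \<in> V \<Longrightarrow> g \<in> V \<Longrightarrow> jp (U f) (U g) = ip f g"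
  by (simp add: transported_ip_def inj)

lemma hnorm_U: "f \<in> V \<Longrightarrow> hnorm jp (U f) = hnorm ip f"
  by (simp add: hnorm_def jp_U)

lemma unitary: "unitary_between V ip (U ` V) jp U"
  by (simp add: unitary_between_def linear jp_U inj inj_on_imp_bij_betw)

lemma inner_product_subspace_image: "inner_product_subspace (U ` V) jp"
proof
  show "cfun.subspace (U ` V)"
  proof (rule cfun.subspaceI)
    show "0 \<in> U ` V"
      using U_zero zero_mem by (metis imageI)
    show "f + g \<in> U ` V" if "f \<in> U ` V" "g \<in> U ` V" for f g
      using that by (auto simp: add_mem simp flip: U_add)
    show "cscale c f \<in> U ` V" if "f \<in> U ` V" for c f
      using that by (auto simp: scale_mem simp flip: U_scale)
  qed
  show "inner_product_on (U ` V) jp"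
    unfolding inner_product_on_def ball_simps
  proof (intro conjI ballI allI impI)
    fix f g h assume "f \<in> V" "g \<in> V" "h \<in> V"
    then show "jp (U f + U g) (U h) = jp (U f) (U h) + jp (U g) (U h)"
      by (simp add: jp_U ip_add_left add_mem flip: U_add)
  next
    fix c f g assume "f \<in> V" "g \<in> V"
    then show "jp (cscale c (U f)) (U g) = c * jp (U f) (U g)"
      by (simp add: jp_U ip_scale_left scale_mem flip: U_scale)
  next
    fix f g assume "f \<in> V" "g \<in> V"
    then show "jp (U g) (U f) = cnj (jp (U f) (U g))"
      using ip_commute[of f g] by (simp add: jp_U)
  next
    fix f assume "f \<in> V"
    then show "0 \<le> Re (jp (U f) (U f))"
      by (simp add: jp_U ip_nonneg)
  next
    fix f assume "f \<in> V" "jp (U f) (U f) = 0"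
    then show "U f = 0"
      using ip_definite[of f] U_zero by (simp add: jp_U)
  qed
qed

lemma hilbert_space_image:
  assumes "mcomplete"
  shows "hilbert_space_on (U ` V) jp"
proof -
  interpret W: inner_product_subspace "U ` V" jp
    by (rule inner_product_subspace_image)
  have "W.mcomplete"
    unfolding W.mcomplete_iff
  proof (intro allI impI; elim conjE)
    fix \<sigma> :: "nat \<Rightarrow> cfun" assume "\<forall>n. \<sigma> n \<in> U ` V"
    then have "\<forall>n. \<exists>f. f \<in> V \<and> \<sigma> n = U f"
      by blast
    then obtain \<tau> where \<tau>: "\<And>n. \<tau> n \<in> V" "\<And>n. \<sigma> n = U (\<tau> n)"
      by metis
    have dist: "hnorm jp (U f - U g) = hnorm ip (f - g)" if "f \<in> V" "g \<in> V" for f g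
      using that by (simp add: hnorm_U diff_mem flip: U_diff)
    assume "\<forall>\<epsilon>>0. \<exists>N. \<forall>m\<ge>N. \<forall>n\<ge>N. hnorm jp (\<sigma> m - \<sigma> n) < \<epsilon>"
    then have "\<forall>\<epsilon>>0. \<exists>N. \<forall>m\<ge>N. \<forall>n\<ge>N. hnorm ip (\<tau> m - \<tau> n) < \<epsilon>"
      by (simp add: \<tau> dist)
    then obtain f where "f \<in> V" "\<forall>\<epsilon>>0. \<exists>N. \<forall>n\<ge>N. hnorm ip (\<tau> n - f) < \<epsilon>"
      using assms \<tau>(1) unfolding mcomplete_iff by blast
    then show "\<exists>g\<in>U ` V. \<forall>\<epsilon>>0. \<exists>N. \<forall>n\<ge>N. hnorm jp (\<sigma> n - g) < \<epsilon>"
      by (intro bexI[of _ "U f"]) (simp_all add: \<tau> dist)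
  qed
  then show ?thesis
    by (simp add: hilbert_space_on_def W.linear_subspace W.inner_product)
qed

end

text \<open>
  Once an operator is intertwined with multiplication by the coordinate through an injective linear
  map into analytic functions whose point values are bounded, transporting the inner product to
  the range of that map produces the reproducing kernel space.
\<close>

lemma is_shiftI:
  assumes V: "hilbert_space_on V ip" and S: "bounded_operator_on V ip S"
    and U: "linear_map_on V U" "inj_on U V"
    and dom: "open \<Omega>" "connected \<Omega>" "\<Omega> \<noteq> {}" "\<And>f. f \<in> V \<Longrightarrow> U f \<in> analytic_functions \<Omega>"
    and eval: "\<And>w. w \<in> \<Omega> \<Longrightarrow> \<exists>C. \<forall>f\<in>V. cmod (U f w) \<le> C * hnorm ip f"
    and intertwines: "\<And>f. f \<in> V \<Longrightarrow> U (S f) = Mz (U f)"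
  shows "is_shift V ip S"
proof -
  interpret injective_image V ip U
    using V U by unfold_locales (simp_all add: hilbert_space_on_def)
  have "analytic_rkhs \<Omega> (U ` V) jp"
    using dom eval hilbert_space_image V
    by (auto simp: analytic_rkhs_def hilbert_space_on_def hnorm_U)
  moreover have SV: "S \<in> V \<rightarrow> V"
    using S by (simp add: bounded_operator_on_def)
  have MzV: "Mz \<in> U ` V \<rightarrow> U ` V"
  proof
    fix g assume "g \<in> U ` V"
    then obtain f where "f \<in> V" "g = U f" by blast
    then show "Mz g \<in> U ` V"
      using SV by (auto simp flip: intertwines)
  qed
  obtain C where C: "\<And>f. f \<in> V \<Longrightarrow> hnorm ip (S f) \<le> C * hnorm ip f"
    using S unfolding bounded_operator_on_def by blast
  have "hnorm jp (Mz (U f)) \<le> C * hnorm jp (U f)" if "f \<in> V" for f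
  proof -
    have "S f \<in> V"
      using SV that by blast
    then show ?thesis
      using C[OF that] that by (simp add: hnorm_U flip: intertwines)
  qed
  then have "bounded_operator_on (U ` V) jp Mz"
    unfolding bounded_operator_on_def
    using MzV by (auto simp: linear_map_on_def Mz_def cscale_def fun_eq_iff algebra_simps)
  moreover have "unitarily_equivalent V ip S (U ` V) jp Mz"
    using SV MzV unitary intertwines by (auto simp: unitarily_equivalent_def)
  ultimately show ?thesis
    unfolding is_shift_def by blast
qed


section \<open>The Hardy space in terms of Taylor coefficients\<close>

text \<open>
  Uniqueness of power series near 0. Every later computation of Taylor coefficients exhibits a
  convergent series for the function and reads the coefficients off, so that no derivative is
  ever computed.
\<close>

lemma taylor_coeff_eqI:
  assumes "\<forall>\<^sub>F w in nhds 0. (\<lambda>n. c n * w ^ n) sums f w"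
  shows "taylor_coeff f = c"
proof
  fix n
  have "f has_fps_expansion Abs_fps c"
    using assms by (intro has_fps_expansionI) simp
  then show "taylor_coeff f n = c n"
    using fps_nth_fps_expansion[of f "Abs_fps c" n] by (simp add: taylor_coeff_def)
qed

lemma taylor_coeff_eqI_disc:
  assumes "\<And>w. w \<in> unit_disc \<Longrightarrow> (\<lambda>n. c n * w ^ n) sums f w"
  shows "taylor_coeff f = c"
  using assms by (intro taylor_coeff_eqI) (auto simp: eventually_nhds intro!: exI[of _ unit_disc])

lemma analytic_functions_sums:
  assumes "f \<in> analytic_functions unit_disc" "w \<in> unit_disc"
  shows "(\<lambda>n. taylor_coeff f n * w ^ n) sums f w"
  using holomorphic_power_series[of f 0 1 w] assms
  by (simp add: analytic_functions_def taylor_coeff_def analytic_imp_holomorphic)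

lemma analytic_functionsI:
  assumes "\<And>w. w \<in> unit_disc \<Longrightarrow> (\<lambda>n. c n * w ^ n) sums f w" "\<And>w. w \<notin> unit_disc \<Longrightarrow> f w = 0"
  shows "f \<in> analytic_functions unit_disc"
  using assms power_series_analytic[of 0 1 c f] by (simp add: analytic_functions_def)

lemma taylor_coeff_inject:
  assumes "f \<in> analytic_functions unit_disc" "g \<in> analytic_functions unit_disc"
    and "taylor_coeff f = taylor_coeff g"
  shows "f = g"
proof
  fix w
  show "f w = g w"
  proof (cases "w \<in> unit_disc")
    case True
    then show ?thesis
      using analytic_functions_sums[OF assms(1)] analytic_functions_sums[OF assms(2)] assms(3)
        sums_unique2 by metis
  qed (use assms in \<open>simp add: analytic_functions_def\<close>)
qed

lemma
  assumes f: "f \<in> analytic_functions unit_disc" and g: "g \<in> analytic_functions unit_disc"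
  shows taylor_coeff_add: "taylor_coeff (f + g) = (\<lambda>n. taylor_coeff f n + taylor_coeff g n)"
    and analytic_functions_add: "f + g \<in> analytic_functions unit_disc"
proof -
  have *: "(\<lambda>n. (taylor_coeff f n + taylor_coeff g n) * w ^ n) sums (f + g) w"
    if "w \<in> unit_disc" for w
    using sums_add[OF analytic_functions_sums[OF f that] analytic_functions_sums[OF g that]]
    by (simp add: distrib_right)
  show "taylor_coeff (f + g) = (\<lambda>n. taylor_coeff f n + taylor_coeff g n)"
    by (rule taylor_coeff_eqI_disc) (rule *)
  show "f + g \<in> analytic_functions unit_disc"
    using f g by (intro analytic_functionsI[OF *]) (auto simp: analytic_functions_def)
qed

lemma
  assumes f: "f \<in> analytic_functions unit_disc"
  shows taylor_coeff_scale: "taylor_coeff (cscale c f) = (\<lambda>n. c * taylor_coeff f n)"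
    and analytic_functions_scale: "cscale c f \<in> analytic_functions unit_disc"
proof -
  have *: "(\<lambda>n. (c * taylor_coeff f n) * w ^ n) sums cscale c f w"
    if "w \<in> unit_disc" for w
    using sums_mult[OF analytic_functions_sums[OF f that]]
    by (simp add: cscale_def mult.assoc)
  show "taylor_coeff (cscale c f) = (\<lambda>n. c * taylor_coeff f n)"
    by (rule taylor_coeff_eqI_disc) (rule *)
  show "cscale c f \<in> analytic_functions unit_disc"
    using f by (intro analytic_functionsI[OF *]) (auto simp: analytic_functions_def cscale_def)
qed

lemma taylor_coeff_zero: "taylor_coeff 0 = (\<lambda>n. 0)"
  by (rule taylor_coeff_eqI_disc) simp

definition square_summable :: "(nat \<Rightarrow> complex) \<Rightarrow> bool" where
  "square_summable c \<longleftrightarrow> summable (\<lambda>n. (cmod (c n))\<^sup>2)"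

lemma square_summable_add:
  assumes "square_summable a" "square_summable b"
  shows "square_summable (\<lambda>n. a n + b n)"
  unfolding square_summable_def
proof (rule summable_comparison_test')
  show "summable (\<lambda>n. 2 * (cmod (a n))\<^sup>2 + 2 * (cmod (b n))\<^sup>2)"
    using assms by (intro summable_add summable_mult) (simp_all add: square_summable_def)
  fix n :: nat
  have "(cmod (a n + b n))\<^sup>2 \<le> (cmod (a n) + cmod (b n))\<^sup>2"
    by (simp add: norm_triangle_ineq power_mono)
  also have "\<dots> \<le> 2 * (cmod (a n))\<^sup>2 + 2 * (cmod (b n))\<^sup>2"
    using zero_le_power2[of "cmod (a n) - cmod (b n)"]
    by (simp add: power2_diff power2_sum)
  finally show "norm ((cmod (a n + b n))\<^sup>2) \<le> 2 * (cmod (a n))\<^sup>2 + 2 * (cmod (b n))\<^sup>2"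
    by simp
qed

lemma square_summable_scale:
  "square_summable a \<Longrightarrow> square_summable (\<lambda>n. c * a n)"
  by (simp add: square_summable_def norm_mult power_mult_distrib summable_mult)

lemma square_summable_shift: "square_summable (\<lambda>n. a (n + k)) \<longleftrightarrow> square_summable a"
  unfolding square_summable_def by (rule summable_iff_shift)

lemma square_summable_finite:
  assumes "finite {n. a n \<noteq> 0}"
  shows "square_summable a"
  unfolding square_summable_def using assms by (intro summable_finite[of "{n. a n \<noteq> 0}"]) auto

lemma summable_mult_cnj:
  assumes "square_summable a" "square_summable b"
  shows "summable (\<lambda>n. a n * cnj (b n))"
proof (rule summable_comparison_test')
  show "summable (\<lambda>n. (cmod (a n))\<^sup>2 + (cmod (b n))\<^sup>2)"
    using assms by (intro summable_add) (simp_all add: square_summable_def)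
  fix n :: nat
  have "2 * (cmod (a n) * cmod (b n)) \<le> (cmod (a n))\<^sup>2 + (cmod (b n))\<^sup>2"
    using zero_le_power2[of "cmod (a n) - cmod (b n)"] by (simp add: power2_diff)
  moreover have "0 \<le> cmod (a n) * cmod (b n)"
    by simp
  ultimately show "norm (a n * cnj (b n)) \<le> (cmod (a n))\<^sup>2 + (cmod (b n))\<^sup>2"
    unfolding norm_mult complex_mod_cnj by linarith
qed

lemma cmod_le_sqrt_suminf:
  assumes "square_summable c"
  shows "cmod (c n) \<le> sqrt (\<Sum>k. (cmod (c k))\<^sup>2)"
  using sum_le_suminf[of "\<lambda>k. (cmod (c k))\<^sup>2" "{n}"] assms
  by (intro real_le_rsqrt) (simp add: square_summable_def)

text \<open>
  Bounding every coefficient by the \<open>\<ell>\<^sup>2\<close> norm and comparing with the geometric series is cruder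
  than Cauchy--Schwarz, which would give \<open>1 / sqrt (1 - |w|\<^sup>2)\<close>, but any bound depending only on \<open>w\<close>
  makes the point evaluations bounded.
\<close>

lemma power_series_square_summable:
  assumes c: "square_summable c" and w: "w \<in> unit_disc"
  shows "summable (\<lambda>n. c n * w ^ n)"
    and "cmod (\<Sum>n. c n * w ^ n) \<le> sqrt (\<Sum>k. (cmod (c k))\<^sup>2) / (1 - cmod w)"
proof -
  let ?B = "sqrt (\<Sum>k. (cmod (c k))\<^sup>2)"
  have w1: "cmod w < 1"
    using w by simp
  have "(\<lambda>n. ?B * cmod w ^ n) sums (?B * (1 / (1 - cmod w)))"
    using w1 by (intro sums_mult geometric_sums) simp
  then have geom: "summable (\<lambda>n. ?B * cmod w ^ n)" "(\<Sum>n. ?B * cmod w ^ n) = ?B / (1 - cmod w)"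
    by (simp_all add: sums_iff)
  have le: "norm (c n * w ^ n) \<le> ?B * cmod w ^ n" for n
    unfolding norm_mult norm_power by (intro mult_right_mono cmod_le_sqrt_suminf c) simp
  show "summable (\<lambda>n. c n * w ^ n)"
    by (rule summable_comparison_test'[OF geom(1) le])
  show "cmod (\<Sum>n. c n * w ^ n) \<le> ?B / (1 - cmod w)"
    using norm_suminf_le[OF le geom(1)] geom(2) by simp
qed

definition power_series_function :: "(nat \<Rightarrow> complex) \<Rightarrow> cfun" where
  "power_series_function c = zero_ext unit_disc (\<lambda>z. \<Sum>n. c n * z ^ n)"

lemma
  assumes "square_summable c"
  shows taylor_coeff_power_series_function: "taylor_coeff (power_series_function c) = c"
    and power_series_function_mem_H2: "power_series_function c \<in> H2"
proof -
  have *: "(\<lambda>n. c n * w ^ n) sums power_series_function c w" if "w \<in> unit_disc" for w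
    using power_series_square_summable(1)[OF assms that] that
    by (simp add: power_series_function_def zero_ext_def summable_sums)
  show tc: "taylor_coeff (power_series_function c) = c"
    by (rule taylor_coeff_eqI_disc) (rule *)
  have "power_series_function c \<in> analytic_functions unit_disc"
    by (intro analytic_functionsI[OF *]) (auto simp: power_series_function_def zero_ext_def)
  then show "power_series_function c \<in> H2"
    using assms by (simp add: H2_def tc square_summable_def)
qed

lemma H2_iff: "f \<in> H2 \<longleftrightarrow> f \<in> analytic_functions unit_disc \<and> square_summable (taylor_coeff f)"
  by (simp add: H2_def square_summable_def)

lemma H2_analytic: "f \<in> H2 \<Longrightarrow> f \<in> analytic_functions unit_disc"
  and H2_square_summable: "f \<in> H2 \<Longrightarrow> square_summable (taylor_coeff f)"
  by (simp_all add: H2_iff)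

lemma subspace_H2: "cfun.subspace H2"
proof (rule cfun.subspaceI)
  show "0 \<in> H2"
    by (auto simp: H2_iff taylor_coeff_zero square_summable_def
        intro!: analytic_functionsI[where c = "\<lambda>n. 0"])
  show "f + g \<in> H2" if "f \<in> H2" "g \<in> H2" for f g
    using that
    by (simp add: H2_iff taylor_coeff_add analytic_functions_add square_summable_add)
  show "cscale c f \<in> H2" if "f \<in> H2" for c f
    using that
    by (simp add: H2_iff taylor_coeff_scale analytic_functions_scale square_summable_scale)
qed

lemma H2_ip_self:
  assumes "f \<in> H2"
  shows "H2_ip f f = of_real (\<Sum>n. (cmod (taylor_coeff f n))\<^sup>2)"
proof -
  have "H2_ip f f = (\<Sum>n. of_real ((cmod (taylor_coeff f n))\<^sup>2))"
    by (simp only: H2_ip_def complex_norm_square)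
  also have "\<dots> = of_real (\<Sum>n. (cmod (taylor_coeff f n))\<^sup>2)"
    using H2_square_summable[OF assms] by (intro suminf_of_real[symmetric]) (simp add: square_summable_def)
  finally show ?thesis .
qed

interpretation H2: inner_product_subspace H2 H2_ip
proof
  show "cfun.subspace H2"
    by (rule subspace_H2)
  show "inner_product_on H2 H2_ip"
    unfolding inner_product_on_def
  proof (intro conjI ballI allI impI)
    fix f g h assume "f \<in> H2" "g \<in> H2" "h \<in> H2"
    then show "H2_ip (f + g) h = H2_ip f h + H2_ip g h"
      unfolding H2_ip_def
      by (subst suminf_add)
        (auto simp: taylor_coeff_add H2_iff distrib_right intro!: summable_mult_cnj)
  next
    fix c f g assume "f \<in> H2" "g \<in> H2"
    then show "H2_ip (cscale c f) g = c * H2_ip f g"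
      unfolding H2_ip_def
      by (subst suminf_mult[symmetric])
        (auto simp: taylor_coeff_scale H2_iff mult.assoc intro!: summable_mult_cnj)
  next
    fix f g assume "f \<in> H2" "g \<in> H2"
    then have "(\<lambda>n. taylor_coeff f n * cnj (taylor_coeff g n)) sums H2_ip f g"
      unfolding H2_ip_def by (intro summable_sums summable_mult_cnj H2_square_summable)
    then have "(\<lambda>n. cnj (taylor_coeff f n * cnj (taylor_coeff g n))) sums cnj (H2_ip f g)"
      by (simp only: sums_cnj)
    then show "H2_ip g f = cnj (H2_ip f g)"
      unfolding H2_ip_def[of g f] by (simp add: sums_iff mult.commute)
  next
    fix f assume "f \<in> H2"
    then show "0 \<le> Re (H2_ip f f)"
      using H2_square_summable[of f]
      by (auto simp: H2_ip_self square_summable_def intro!: suminf_nonneg)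
  next
    fix f assume f: "f \<in> H2" "H2_ip f f = 0"
    then have "(\<Sum>n. (cmod (taylor_coeff f n))\<^sup>2) = 0"
      by (simp add: H2_ip_self)
    then have "\<forall>n. (cmod (taylor_coeff f n))\<^sup>2 = 0"
      using H2_square_summable[OF f(1)]
      by (subst (asm) suminf_eq_zero_iff) (auto simp: square_summable_def)
    then have "taylor_coeff f = taylor_coeff 0"
      by (simp add: taylor_coeff_zero fun_eq_iff)
    moreover have "0 \<in> analytic_functions unit_disc"
      using cfun.subspace_0[OF subspace_H2] H2_analytic by blast
    ultimately show "f = 0"
      using f H2_analytic taylor_coeff_inject by blast
  qed
qed

lemma hnorm_H2: "f \<in> H2 \<Longrightarrow> hnorm H2_ip f = sqrt (\<Sum>n. (cmod (taylor_coeff f n))\<^sup>2)"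
  by (simp add: hnorm_def H2_ip_self)

lemma cmod_taylor_coeff_le: "f \<in> H2 \<Longrightarrow> cmod (taylor_coeff f n) \<le> hnorm H2_ip f"
  using cmod_le_sqrt_suminf[OF H2_square_summable] by (simp add: hnorm_H2)

lemma taylor_coeff_diff:
  assumes "f \<in> H2" "g \<in> H2"
  shows "taylor_coeff (f - g) n = taylor_coeff f n - taylor_coeff g n"
proof -
  have "taylor_coeff ((f - g) + g) n = taylor_coeff (f - g) n + taylor_coeff g n"
    using assms by (subst taylor_coeff_add) (simp_all add: H2_analytic H2.diff_mem)
  then show ?thesis
    by simp
qed

text \<open>
  Completeness of \<open>\<ell>\<^sup>2\<close>: coefficients of a Cauchy sequence converge one by one, and a bound on the
  finite partial sums of \<open>\<parallel>\<sigma> m - \<sigma> n\<parallel>\<^sup>2\<close> survives the limit in \<open>m\<close>.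
\<close>

lemma H2_mcomplete: "H2.mcomplete"
  unfolding H2.mcomplete_iff
proof (intro allI impI; elim conjE)
  fix \<sigma> :: "nat \<Rightarrow> cfun"
  assume \<sigma>: "\<forall>n. \<sigma> n \<in> H2"
    and cauchy: "\<forall>\<epsilon>>0. \<exists>N. \<forall>m\<ge>N. \<forall>n\<ge>N. hnorm H2_ip (\<sigma> m - \<sigma> n) < \<epsilon>"
  let ?t = "\<lambda>m k. taylor_coeff (\<sigma> m) k"
  have "Cauchy (\<lambda>m. ?t m k)" for k
  proof (rule CauchyI)
    fix \<epsilon> :: real assume "\<epsilon> > 0"
    then obtain N where N: "\<forall>m\<ge>N. \<forall>n\<ge>N. hnorm H2_ip (\<sigma> m - \<sigma> n) < \<epsilon>"
      using cauchy by blast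
    have "norm (?t m k - ?t n k) < \<epsilon>" if "m \<ge> N" "n \<ge> N" for m n
      using N that \<sigma> cmod_taylor_coeff_le[of "\<sigma> m - \<sigma> n" k] H2.diff_mem[of "\<sigma> m" "\<sigma> n"]
      by (auto simp: taylor_coeff_diff intro: le_less_trans)
    then show "\<exists>N. \<forall>m\<ge>N. \<forall>n\<ge>N. norm (?t m k - ?t n k) < \<epsilon>"
      by blast
  qed
  then have "\<forall>k. \<exists>b. (\<lambda>m. ?t m k) \<longlonglongrightarrow> b"
    by (simp add: Cauchy_convergent_iff convergent_def)
  then obtain b where b: "\<And>k. (\<lambda>m. ?t m k) \<longlonglongrightarrow> b k"
    by metis
  have tail: "\<exists>N. \<forall>n\<ge>N. \<forall>K. (\<Sum>k<K. (cmod (?t n k - b k))\<^sup>2) \<le> \<epsilon>\<^sup>2" if "\<epsilon> > 0" for \<epsilon>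
  proof -
    obtain N where N: "\<And>m n. m \<ge> N \<Longrightarrow> n \<ge> N \<Longrightarrow> hnorm H2_ip (\<sigma> m - \<sigma> n) < \<epsilon>"
      using cauchy \<open>\<epsilon> > 0\<close> by blast
    have "(\<Sum>k<K. (cmod (?t n k - b k))\<^sup>2) \<le> \<epsilon>\<^sup>2" if n: "n \<ge> N" for n K
    proof (rule LIMSEQ_le_const2)
      show "(\<lambda>m. \<Sum>k<K. (cmod (?t n k - ?t m k))\<^sup>2) \<longlonglongrightarrow> (\<Sum>k<K. (cmod (?t n k - b k))\<^sup>2)"
        by (intro tendsto_intros b)
      have "(\<Sum>k<K. (cmod (?t n k - ?t m k))\<^sup>2) \<le> \<epsilon>\<^sup>2" if "m \<ge> N" for m
      proof -
        have d: "\<sigma> n - \<sigma> m \<in> H2"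
          using \<sigma> H2.diff_mem by blast
        have "(\<Sum>k<K. (cmod (?t n k - ?t m k))\<^sup>2)
            = (\<Sum>k<K. (cmod (taylor_coeff (\<sigma> n - \<sigma> m) k))\<^sup>2)"
          using \<sigma> by (simp add: taylor_coeff_diff)
        also have "\<dots> \<le> (\<Sum>k. (cmod (taylor_coeff (\<sigma> n - \<sigma> m) k))\<^sup>2)"
          using H2_square_summable[OF d] by (intro sum_le_suminf) (auto simp: square_summable_def)
        also have "\<dots> = (hnorm H2_ip (\<sigma> n - \<sigma> m))\<^sup>2"
          using d by (simp add: H2.hnorm_square H2_ip_self)
        also have "\<dots> \<le> \<epsilon>\<^sup>2"
          using N[OF n that] H2.hnorm_nonneg[OF d] by (intro power_mono) auto
        finally show ?thesis .
      qed
      then show "\<exists>N. \<forall>m\<ge>N. (\<Sum>k<K. (cmod (?t n k - ?t m k))\<^sup>2) \<le> \<epsilon>\<^sup>2"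
        by blast
    qed
    then show ?thesis
      by blast
  qed
  have diff_square_summable: "square_summable (\<lambda>k. ?t n k - b k)"
    if "\<forall>K. (\<Sum>k<K. (cmod (?t n k - b k))\<^sup>2) \<le> B" for n B
    using that unfolding square_summable_def by (intro summableI_nonneg_bounded) auto
  \<comment> \<open>The limit sequence is a square summable perturbation of one member of the sequence.\<close>
  obtain n\<^sub>0 where "square_summable (\<lambda>k. ?t n\<^sub>0 k - b k)"
    using tail[of 1] diff_square_summable by (metis order_refl zero_less_one)
  then have "square_summable (\<lambda>k. ?t n\<^sub>0 k + (-1) * (?t n\<^sub>0 k - b k))"
    using \<sigma> by (intro square_summable_add square_summable_scale H2_square_summable) auto
  then have sb: "square_summable b"
    by simp
  define f where "f = power_series_function b"
  have f: "f \<in> H2" "taylor_coeff f = b"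
    using sb by (simp_all add: f_def power_series_function_mem_H2 taylor_coeff_power_series_function)
  show "\<exists>f\<in>H2. \<forall>\<epsilon>>0. \<exists>N. \<forall>n\<ge>N. hnorm H2_ip (\<sigma> n - f) < \<epsilon>"
  proof (rule bexI[OF _ f(1)], intro allI impI)
    fix \<epsilon> :: real assume "\<epsilon> > 0"
    then obtain N where N: "\<forall>n\<ge>N. \<forall>K. (\<Sum>k<K. (cmod (?t n k - b k))\<^sup>2) \<le> (\<epsilon>/2)\<^sup>2"
      using tail[of "\<epsilon>/2"] by auto
    have "hnorm H2_ip (\<sigma> n - f) < \<epsilon>" if "n \<ge> N" for n
    proof -
      have "(\<Sum>k. (cmod (?t n k - b k))\<^sup>2) \<le> (\<epsilon>/2)\<^sup>2"
        using diff_square_summable[of n "(\<epsilon>/2)\<^sup>2"] N that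
        by (intro suminf_le_const) (auto simp: square_summable_def)
      then have "sqrt (\<Sum>k. (cmod (?t n k - b k))\<^sup>2) \<le> \<epsilon>/2"
        using \<open>\<epsilon> > 0\<close> by (intro real_le_lsqrt) auto
      then have "hnorm H2_ip (\<sigma> n - f) \<le> \<epsilon>/2"
        using \<sigma> f by (simp add: hnorm_H2 H2.diff_mem taylor_coeff_diff)
      then show ?thesis
        using \<open>\<epsilon> > 0\<close> by simp
    qed
    then show "\<exists>N. \<forall>n\<ge>N. hnorm H2_ip (\<sigma> n - f) < \<epsilon>"
      by blast
  qed
qed


section \<open>The space \<open>H\<^sup>2\<^sub>\<alpha>\<^sub>,\<^sub>\<beta>\<close> and the compressed shift in coefficients\<close>

lemma
  assumes "finite A" "\<And>n. n \<notin> A \<Longrightarrow> c n = 0"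
    and "\<And>w. w \<in> unit_disc \<Longrightarrow> p w = (\<Sum>n\<in>A. c n * w ^ n)"
  shows taylor_coeff_polynomial: "taylor_coeff (zero_ext unit_disc p) = c"
    and polynomial_mem_H2: "zero_ext unit_disc p \<in> H2"
proof -
  have *: "(\<lambda>n. c n * w ^ n) sums zero_ext unit_disc p w" if "w \<in> unit_disc" for w
    using assms that sums_finite[of A "\<lambda>n. c n * w ^ n"] by (simp add: zero_ext_def)
  show tc: "taylor_coeff (zero_ext unit_disc p) = c"
    by (rule taylor_coeff_eqI_disc) (rule *)
  have "finite {n. c n \<noteq> 0}"
    using assms by (auto intro: finite_subset[of _ A])
  moreover have "zero_ext unit_disc p \<in> analytic_functions unit_disc"
    by (intro analytic_functionsI[OF *]) (simp_all add: zero_ext_def)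
  ultimately show "zero_ext unit_disc p \<in> H2"
    by (simp add: H2_iff tc square_summable_finite)
qed

lemma
  shows taylor_coeff_monomial:
      "taylor_coeff (zero_ext unit_disc (\<lambda>z. z ^ m)) = (\<lambda>n. if n = m then 1 else 0)"
    and monomial_mem_H2: "zero_ext unit_disc (\<lambda>z. z ^ m) \<in> H2"
  using taylor_coeff_polynomial[of "{m}" "\<lambda>n. if n = m then 1 else 0" "\<lambda>z. z ^ m"]
    polynomial_mem_H2[of "{m}" "\<lambda>n. if n = m then 1 else 0" "\<lambda>z. z ^ m"]
  by auto

lemma
  shows taylor_coeff_affine: "taylor_coeff (zero_ext unit_disc (\<lambda>z. \<alpha> + \<beta> * z)) =
      (\<lambda>n. if n = 0 then \<alpha> else if n = 1 then \<beta> else 0)"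
    and affine_mem_H2: "zero_ext unit_disc (\<lambda>z. \<alpha> + \<beta> * z) \<in> H2"
  using taylor_coeff_polynomial[of "{0, 1}" "\<lambda>n. if n = 0 then \<alpha> else if n = 1 then \<beta> else 0"
      "\<lambda>z. \<alpha> + \<beta> * z"]
    polynomial_mem_H2[of "{0, 1}" "\<lambda>n. if n = 0 then \<alpha> else if n = 1 then \<beta> else 0"
      "\<lambda>z. \<alpha> + \<beta> * z"]
  by auto

lemma H2_eqI: "f \<in> H2 \<Longrightarrow> g \<in> H2 \<Longrightarrow> (\<And>n. taylor_coeff f n = taylor_coeff g n) \<Longrightarrow> f = g"
  using taylor_coeff_inject H2_analytic by blast

lemma H2_taylor_coeff_add:
  "f \<in> H2 \<Longrightarrow> g \<in> H2 \<Longrightarrow> taylor_coeff (f + g) = (\<lambda>n. taylor_coeff f n + taylor_coeff g n)"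
  and H2_taylor_coeff_scale:
  "f \<in> H2 \<Longrightarrow> taylor_coeff (cscale c f) = (\<lambda>n. c * taylor_coeff f n)"
  by (simp_all add: taylor_coeff_add taylor_coeff_scale H2_analytic)

text \<open>
  The functions orthogonal to \<open>cnj \<beta> - cnj \<alpha> z\<close>; \<open>H2_ab_eq\<close> shows that this is the space
  \<open>H\<^sup>2\<^sub>\<alpha>\<^sub>,\<^sub>\<beta>\<close>.
\<close>

definition constraint_space :: "complex \<Rightarrow> complex \<Rightarrow> cfun set" where
  "constraint_space \<alpha> \<beta> = {f \<in> H2. \<beta> * taylor_coeff f 0 = \<alpha> * taylor_coeff f 1}"

lemma subspace_constraint_space: "cfun.subspace (constraint_space \<alpha> \<beta>)"
  by (rule cfun.subspaceI)
    (auto simp: constraint_space_def H2.zero_mem H2.add_mem H2.scale_mem taylor_coeff_zero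
      H2_taylor_coeff_add H2_taylor_coeff_scale algebra_simps)

definition truncate :: "cfun \<Rightarrow> nat \<Rightarrow> cfun" where
  "truncate f N = power_series_function (\<lambda>n. if n < N then taylor_coeff f n else 0)"

lemma
  shows taylor_coeff_truncate:
      "taylor_coeff (truncate f N) = (\<lambda>n. if n < N then taylor_coeff f n else 0)"
    and truncate_mem_H2: "truncate f N \<in> H2"
proof -
  have "square_summable (\<lambda>n. if n < N then taylor_coeff f n else 0)"
    by (rule square_summable_finite) (auto intro: finite_subset[of _ "{..<N}"])
  then show "taylor_coeff (truncate f N) = (\<lambda>n. if n < N then taylor_coeff f n else 0)"
    "truncate f N \<in> H2"
    by (simp_all add: truncate_def taylor_coeff_power_series_function power_series_function_mem_H2)
qed

lemma truncate_Suc: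
  "truncate f (Suc N) = truncate f N + cscale (taylor_coeff f N) (zero_ext unit_disc (\<lambda>z. z ^ N))"
  by (rule H2_eqI)
    (auto simp: less_Suc_eq truncate_mem_H2 H2.add_mem H2.scale_mem monomial_mem_H2 taylor_coeff_truncate
      H2_taylor_coeff_add H2_taylor_coeff_scale taylor_coeff_monomial)

lemma truncate_tendsto:
  assumes "f \<in> H2" "r > 0"
  shows "\<exists>N\<ge>M. hnorm H2_ip (f - truncate f N) < r"
proof -
  let ?q = "\<lambda>n. (cmod (taylor_coeff f n))\<^sup>2"
  have q: "summable ?q"
    using H2_square_summable[OF assms(1)] by (simp add: square_summable_def)
  obtain N where N: "\<forall>n\<ge>N. norm (\<Sum>i. ?q (i + n)) < r\<^sup>2"
    using suminf_exist_split[OF _ q, of "r\<^sup>2"] assms(2) by auto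
  let ?N = "max M N"
  have d: "f - truncate f ?N \<in> H2"
    using assms(1) truncate_mem_H2 by (rule H2.diff_mem)
  have "(\<Sum>n. (cmod (taylor_coeff (f - truncate f ?N) n))\<^sup>2) = (\<Sum>i. ?q (i + ?N))"
    using H2_square_summable[OF d] unfolding square_summable_def
    by (subst suminf_split_initial_segment[where k = ?N])
      (simp_all add: taylor_coeff_diff assms(1) truncate_mem_H2 taylor_coeff_truncate)
  also have "\<dots> < r\<^sup>2"
    using N[rule_format, of ?N] by auto
  finally have "hnorm H2_ip (f - truncate f ?N) < r"
    using assms(2) d by (simp add: hnorm_H2 real_less_lsqrt)
  then show ?thesis
    using max.cobounded1 by blast
qed

text \<open>
  The linear constraint on the first two coefficients holds on the generators and passes to
  limits, because coefficients are bounded by the norm. Conversely, the constraint says that the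
  part of degree at most 1 is a multiple of \<open>\<alpha> + \<beta>z\<close>, so every Taylor polynomial of degree at
  least 1 lies in the span, and the Taylor polynomials converge to \<open>f\<close> in norm.
\<close>

lemma H2_ab_eq:
  assumes "\<alpha> \<noteq> 0"
  shows "H2_ab \<alpha> \<beta> = constraint_space \<alpha> \<beta>"
proof (rule subset_antisym)
  let ?G = "insert (zero_ext unit_disc (\<lambda>z. \<alpha> + \<beta> * z))
    {zero_ext unit_disc (\<lambda>z. z ^ n) | n. n \<ge> 2}"
  have H2_ab: "H2_ab \<alpha> \<beta> = {f \<in> H2. \<forall>r>0. \<exists>g\<in>cfun.span ?G. g \<in> H2 \<and> hnorm H2_ip (f - g) < r}"
    unfolding H2_ab_def H2.metric_closure_of by (auto simp: H2.in_mball hdist_def)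
  have "?G \<subseteq> constraint_space \<alpha> \<beta>"
    by (auto simp: constraint_space_def affine_mem_H2 monomial_mem_H2 taylor_coeff_affine
        taylor_coeff_monomial)
  then have span: "cfun.span ?G \<subseteq> constraint_space \<alpha> \<beta>"
    by (rule cfun.span_minimal) (rule subspace_constraint_space)
  show "H2_ab \<alpha> \<beta> \<subseteq> constraint_space \<alpha> \<beta>"
  proof
    fix f assume f: "f \<in> H2_ab \<alpha> \<beta>"
    let ?e = "\<beta> * taylor_coeff f 0 - \<alpha> * taylor_coeff f 1"
    have fH: "f \<in> H2"
      using f by (simp add: H2_ab)
    have "cmod ?e \<le> 0 + r" if "r > 0" for r
    proof -
      let ?K = "cmod \<beta> + cmod \<alpha>"
      have K: "?K > 0"
        using assms by (simp add: add_nonneg_pos)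
      then have "r / ?K > 0"
        using that by simp
      then obtain g where g: "g \<in> constraint_space \<alpha> \<beta>" "hnorm H2_ip (f - g) < r / ?K"
        using f span unfolding H2_ab by blast
      then have gH: "g \<in> H2"
        by (simp add: constraint_space_def)
      have "?e = \<beta> * taylor_coeff (f - g) 0 - \<alpha> * taylor_coeff (f - g) 1"
        using g fH gH by (simp add: taylor_coeff_diff constraint_space_def algebra_simps)
      also have "cmod \<dots> \<le> cmod \<beta> * cmod (taylor_coeff (f - g) 0)
          + cmod \<alpha> * cmod (taylor_coeff (f - g) 1)"
        using norm_triangle_ineq4 by (metis norm_mult)
      also have "\<dots> \<le> cmod \<beta> * (r / ?K) + cmod \<alpha> * (r / ?K)"
        using cmod_taylor_coeff_le[OF H2.diff_mem[OF fH gH]] g(2)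
        by (intro add_mono mult_left_mono) (auto intro: order_trans less_imp_le)
      also have "\<dots> = r"
        using K by (subst distrib_right[symmetric]) simp
      finally show ?thesis
        by simp
    qed
    then have "cmod ?e \<le> 0"
      by (rule field_le_epsilon)
    then show "f \<in> constraint_space \<alpha> \<beta>"
      using fH by (simp add: constraint_space_def)
  qed
  show "constraint_space \<alpha> \<beta> \<subseteq> H2_ab \<alpha> \<beta>"
  proof
    fix f assume f: "f \<in> constraint_space \<alpha> \<beta>"
    then have fH: "f \<in> H2"
      by (simp add: constraint_space_def)
    have span: "truncate f N \<in> cfun.span ?G" if "N \<ge> 2" for N
      using that
    proof (induction N rule: dec_induct)
      case base
      have f1: "taylor_coeff f 1 = taylor_coeff f 0 / \<alpha> * \<beta>"
        using f assms by (simp add: constraint_space_def field_simps)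
      have "truncate f 2 =
          cscale (taylor_coeff f 0 / \<alpha>) (zero_ext unit_disc (\<lambda>z. \<alpha> + \<beta> * z))"
      proof (rule H2_eqI)
        fix n :: nat
        consider "n = 0" | "n = 1" | "n \<ge> 2"
          by linarith
        then show "taylor_coeff (truncate f 2) n = taylor_coeff
            (cscale (taylor_coeff f 0 / \<alpha>) (zero_ext unit_disc (\<lambda>z. \<alpha> + \<beta> * z))) n"
          unfolding taylor_coeff_truncate H2_taylor_coeff_scale[OF affine_mem_H2]
            taylor_coeff_affine
          using f1 assms by cases simp_all
      qed (intro truncate_mem_H2 H2.scale_mem affine_mem_H2)+
      then show ?case
        by (simp add: cfun.span_base cfun.span_scale)
    next
      case (step N)
      then have "zero_ext unit_disc (\<lambda>z. z ^ N) \<in> ?G"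
        by blast
      then show ?case
        unfolding truncate_Suc
        by (rule cfun.span_add[OF step.IH cfun.span_scale[OF cfun.span_base]])
    qed
    have "\<exists>g\<in>cfun.span ?G. g \<in> H2 \<and> hnorm H2_ip (f - g) < r" if "r > 0" for r
      using truncate_tendsto[OF fH that, of 2] span truncate_mem_H2 by blast
    then show "f \<in> H2_ab \<alpha> \<beta>"
      using fH by (simp add: H2_ab)
  qed
qed

lemma
  assumes f: "f \<in> H2"
  shows taylor_coeff_Mz: "taylor_coeff (Mz f) = (\<lambda>n. if n = 0 then 0 else taylor_coeff f (n - 1))"
    and Mz_mem_H2: "Mz f \<in> H2"
proof -
  let ?c = "\<lambda>n. if n = 0 then 0 else taylor_coeff f (n - 1)"
  have *: "(\<lambda>n. ?c n * w ^ n) sums Mz f w" if "w \<in> unit_disc" for w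
    using sums_mult[OF analytic_functions_sums[OF H2_analytic[OF f] that], of w]
      sums_Suc_iff[of "\<lambda>n. ?c n * w ^ n" "w * f w"]
    by (simp add: Mz_def mult_ac)
  show tc: "taylor_coeff (Mz f) = ?c"
    by (rule taylor_coeff_eqI_disc) (rule *)
  have "Mz f \<in> analytic_functions unit_disc"
    using H2_analytic[OF f]
    by (intro analytic_functionsI[OF *]) (auto simp: analytic_functions_def Mz_def)
  moreover have "square_summable ?c"
    using square_summable_shift[of ?c 1] H2_square_summable[OF f] by simp
  ultimately show "Mz f \<in> H2"
    by (simp add: H2_iff tc)
qed

text \<open>
  The coefficients of
  \<open>z f - \<langle>z f, e\<rangle> e\<close> with \<open>e = cnj \<beta> - cnj \<alpha> z\<close>, where \<open>\<langle>z f, e\<rangle> = - \<alpha> f\<^sub>0\<close>; the degree 1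
  coefficient is \<open>(1 - |\<alpha>|\<^sup>2) f\<^sub>0 = |\<beta>|\<^sup>2 f\<^sub>0\<close> because \<open>|\<alpha>|\<^sup>2 + |\<beta>|\<^sup>2 = 1\<close>.
\<close>

definition compressed_shift_coeff ::
    "complex \<Rightarrow> complex \<Rightarrow> (nat \<Rightarrow> complex) \<Rightarrow> nat \<Rightarrow> complex" where
  "compressed_shift_coeff \<alpha> \<beta> c n =
     (if n = 0 then \<alpha> * cnj \<beta> * c 0 else if n = 1 then \<beta> * cnj \<beta> * c 0 else c (n - 1))"

text \<open>
  The difference between \<open>z f\<close> and the candidate is \<open>- \<alpha> f\<^sub>0 (cnj \<beta> - cnj \<alpha> z)\<close>, which the
  constraint makes orthogonal to the space.
\<close>

lemma
  assumes f: "f \<in> constraint_space \<alpha> \<beta>" and \<alpha>: "\<alpha> \<noteq> 0" and norm: "(cmod \<alpha>)\<^sup>2 + (cmod \<beta>)\<^sup>2 = 1"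
  shows S_ab_mem: "S_ab \<alpha> \<beta> f \<in> constraint_space \<alpha> \<beta>"
    and taylor_coeff_S_ab:
      "taylor_coeff (S_ab \<alpha> \<beta> f) = compressed_shift_coeff \<alpha> \<beta> (taylor_coeff f)"
proof -
  let ?c = "compressed_shift_coeff \<alpha> \<beta> (taylor_coeff f)"
  define g where "g = power_series_function ?c"
  have fH: "f \<in> H2"
    using f by (simp add: constraint_space_def)
  have "square_summable ?c"
    using square_summable_shift[of ?c 2] square_summable_shift[of "taylor_coeff f" 1]
      H2_square_summable[OF fH]
    by (simp add: compressed_shift_coeff_def)
  then have gH: "g \<in> H2" and tg: "taylor_coeff g = ?c"
    by (simp_all add: g_def power_series_function_mem_H2 taylor_coeff_power_series_function)
  have g: "g \<in> constraint_space \<alpha> \<beta>"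
    using gH by (simp add: constraint_space_def tg compressed_shift_coeff_def)
  have "H2_ip (Mz f - g) h = 0" if h: "h \<in> constraint_space \<alpha> \<beta>" for h
  proof -
    let ?d = "\<lambda>n. taylor_coeff (Mz f - g) n * cnj (taylor_coeff h n)"
    have unit: "1 - \<beta> * cnj \<beta> = \<alpha> * cnj \<alpha>"
      using norm unfolding complex_norm_square[symmetric]
      by (metis add_diff_cancel_right' of_real_1 of_real_add)
    have d: "taylor_coeff (Mz f - g) n =
        (if n = 0 then 0 else taylor_coeff f (n - 1)) - ?c n" for n
      using fH gH by (simp add: taylor_coeff_diff Mz_mem_H2 taylor_coeff_Mz tg)
    have "H2_ip (Mz f - g) h = (\<Sum>n\<in>{0, 1}. ?d n)"
      unfolding H2_ip_def
      by (rule suminf_finite) (auto simp: d compressed_shift_coeff_def)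
    also have "\<dots> = \<alpha> * taylor_coeff f 0 * (cnj \<alpha> * cnj (taylor_coeff h 1)
        - cnj \<beta> * cnj (taylor_coeff h 0))"
    proof -
      have "taylor_coeff (Mz f - g) 1 = (1 - \<beta> * cnj \<beta>) * taylor_coeff f 0"
        by (simp add: d compressed_shift_coeff_def algebra_simps)
      then have d1: "taylor_coeff (Mz f - g) 1 = \<alpha> * cnj \<alpha> * taylor_coeff f 0"
        by (simp only: unit)
      have d0: "taylor_coeff (Mz f - g) 0 = - \<alpha> * cnj \<beta> * taylor_coeff f 0"
        by (simp add: d compressed_shift_coeff_def)
      have "(\<Sum>n\<in>{0, 1}. ?d n) = ?d 0 + ?d 1"
        by simp
      then show ?thesis
        unfolding d0 d1 by (simp add: algebra_simps)
    qed
    also have "\<dots> = 0"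
      using h by (simp add: constraint_space_def flip: complex_cnj_mult)
    finally show ?thesis .
  qed
  then have "S_ab \<alpha> \<beta> f = g"
    unfolding S_ab_def H2_ab_eq[OF \<alpha>]
    using g fH
    by (intro H2.orth_proj_eqI subspace_constraint_space)
      (auto simp: constraint_space_def Mz_mem_H2)
  then show "S_ab \<alpha> \<beta> f \<in> constraint_space \<alpha> \<beta>" "taylor_coeff (S_ab \<alpha> \<beta> f) = ?c"
    using g tg by simp_all
qed

lemma bounded_S_ab:
  assumes \<alpha>: "\<alpha> \<noteq> 0" and norm: "(cmod \<alpha>)\<^sup>2 + (cmod \<beta>)\<^sup>2 = 1"
  shows "bounded_operator_on (constraint_space \<alpha> \<beta>) H2_ip (S_ab \<alpha> \<beta>)"
  unfolding bounded_operator_on_def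
proof (intro conjI)
  let ?V = "constraint_space \<alpha> \<beta>"
  note mem = S_ab_mem[OF _ assms] and coeff = taylor_coeff_S_ab[OF _ assms]
  have VH: "f \<in> H2" if "f \<in> ?V" for f
    using that by (simp add: constraint_space_def)
  show "S_ab \<alpha> \<beta> \<in> ?V \<rightarrow> ?V"
    using mem by blast
  show "linear_map_on ?V (S_ab \<alpha> \<beta>)"
    unfolding linear_map_on_def
  proof (intro conjI ballI allI)
    fix f g assume fg: "f \<in> ?V" "g \<in> ?V"
    then have "f + g \<in> ?V"
      using cfun.subspace_add[OF subspace_constraint_space] by blast
    then show "S_ab \<alpha> \<beta> (f + g) = S_ab \<alpha> \<beta> f + S_ab \<alpha> \<beta> g"
      using fg
      by (intro H2_eqI)
        (simp_all add: VH mem coeff H2.add_mem H2_taylor_coeff_add compressed_shift_coeff_def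
          algebra_simps)
  next
    fix c f assume f: "f \<in> ?V"
    then have "cscale c f \<in> ?V"
      using cfun.subspace_scale[OF subspace_constraint_space] by blast
    then show "S_ab \<alpha> \<beta> (cscale c f) = cscale c (S_ab \<alpha> \<beta> f)"
      using f
      by (intro H2_eqI)
        (simp_all add: VH mem coeff H2.scale_mem H2_taylor_coeff_scale compressed_shift_coeff_def)
  qed
  have "hnorm H2_ip (S_ab \<alpha> \<beta> f) \<le> 1 * hnorm H2_ip f" if f: "f \<in> ?V" for f
  proof -
    let ?t = "taylor_coeff f" and ?c = "compressed_shift_coeff \<alpha> \<beta> (taylor_coeff f)"
    have sf: "summable (\<lambda>n. (cmod (?t n))\<^sup>2)"
      using H2_square_summable[OF VH[OF f]] by (simp add: square_summable_def)
    have sc: "summable (\<lambda>n. (cmod (?c n))\<^sup>2)"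
      using H2_square_summable[OF VH[OF mem[OF f]]] by (simp add: square_summable_def coeff f)
    have "(\<Sum>n. (cmod (?c n))\<^sup>2) = (\<Sum>n. (cmod (?c (n + 2)))\<^sup>2) + (\<Sum>n<2. (cmod (?c n))\<^sup>2)"
      by (rule suminf_split_initial_segment[OF sc])
    also have "(\<Sum>n. (cmod (?c (n + 2)))\<^sup>2) = (\<Sum>n. (cmod (?t (n + 1)))\<^sup>2)"
      by (simp add: compressed_shift_coeff_def)
    \<comment> \<open>The first two coefficients contribute
      \<open>(|\<alpha>|\<^sup>2 + |\<beta>|\<^sup>2) |\<beta>|\<^sup>2 |f\<^sub>0|\<^sup>2 = |\<beta>|\<^sup>2 |f\<^sub>0|\<^sup>2 \<le> |f\<^sub>0|\<^sup>2\<close>.\<close>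
    also have "(\<Sum>n<2. (cmod (?c n))\<^sup>2) =
        ((cmod \<alpha>)\<^sup>2 + (cmod \<beta>)\<^sup>2) * ((cmod \<beta>)\<^sup>2 * (cmod (?t 0))\<^sup>2)"
      by (simp add: compressed_shift_coeff_def numeral_2_eq_2 norm_mult power_mult_distrib
          algebra_simps)
    also have "\<dots> \<le> (\<Sum>n<1. (cmod (?t n))\<^sup>2)"
      using norm mult_right_mono[of "(cmod \<beta>)\<^sup>2" 1 "(cmod (?t 0))\<^sup>2"] zero_le_power2[of "cmod \<alpha>"]
      by simp
    also have "(\<Sum>n. (cmod (?t (n + 1)))\<^sup>2) + (\<Sum>n<1. (cmod (?t n))\<^sup>2) = (\<Sum>n. (cmod (?t n))\<^sup>2)"
      by (rule suminf_split_initial_segment[OF sf, symmetric])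
    finally show ?thesis
      using VH[OF f] VH[OF mem[OF f]] by (simp add: hnorm_H2 coeff f)
  qed
  then show "\<exists>C. \<forall>f\<in>?V. hnorm H2_ip (S_ab \<alpha> \<beta> f) \<le> C * hnorm H2_ip f"
    by blast
qed

text \<open>
  Limits taken in the Hardy space preserve the constraint, so the closed subspace inherits
  completeness.
\<close>

lemma constraint_space_hilbert: "hilbert_space_on (constraint_space \<alpha> \<beta>) H2_ip"
proof -
  let ?V = "constraint_space \<alpha> \<beta>"
  have VH: "?V \<subseteq> H2"
    by (auto simp: constraint_space_def)
  interpret V: inner_product_subspace ?V H2_ip
  proof
    show "inner_product_on ?V H2_ip"
      using H2.inner_product VH unfolding inner_product_on_def by (meson subsetD)
  qed (rule subspace_constraint_space)
  have "V.mcomplete"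
    unfolding V.mcomplete_iff
  proof (intro allI impI; elim conjE)
    fix \<sigma> :: "nat \<Rightarrow> cfun"
    assume \<sigma>: "\<forall>n. \<sigma> n \<in> ?V"
      and cauchy: "\<forall>\<epsilon>>0. \<exists>N. \<forall>m\<ge>N. \<forall>n\<ge>N. hnorm H2_ip (\<sigma> m - \<sigma> n) < \<epsilon>"
    then obtain f where f: "f \<in> H2" "\<forall>\<epsilon>>0. \<exists>N. \<forall>n\<ge>N. hnorm H2_ip (\<sigma> n - f) < \<epsilon>"
      using H2_mcomplete VH unfolding H2.mcomplete_iff by blast
    have "(\<lambda>n. taylor_coeff (\<sigma> n) k) \<longlonglongrightarrow> taylor_coeff f k" for k
    proof (rule LIMSEQ_I)
      fix \<epsilon> :: real assume "\<epsilon> > 0"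
      then obtain N where N: "\<forall>n\<ge>N. hnorm H2_ip (\<sigma> n - f) < \<epsilon>"
        using f by blast
      have "norm (taylor_coeff (\<sigma> n) k - taylor_coeff f k) < \<epsilon>" if "n \<ge> N" for n
      proof -
        have "\<sigma> n \<in> H2"
          using \<sigma> VH by blast
        then show ?thesis
          using N that f cmod_taylor_coeff_le[of "\<sigma> n - f" k] H2.diff_mem[of "\<sigma> n" f]
          by (fastforce simp: taylor_coeff_diff)
      qed
      then show "\<exists>N. \<forall>n\<ge>N. norm (taylor_coeff (\<sigma> n) k - taylor_coeff f k) < \<epsilon>"
        by blast
    qed
    then have "(\<lambda>n. \<beta> * taylor_coeff (\<sigma> n) 0) \<longlonglongrightarrow> \<beta> * taylor_coeff f 0"
      "(\<lambda>n. \<alpha> * taylor_coeff (\<sigma> n) 1) \<longlonglongrightarrow> \<alpha> * taylor_coeff f 1"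
      by (intro tendsto_intros; simp)+
    moreover have "(\<lambda>n. \<beta> * taylor_coeff (\<sigma> n) 0) = (\<lambda>n. \<alpha> * taylor_coeff (\<sigma> n) 1)"
      using \<sigma> by (simp add: constraint_space_def)
    ultimately have "\<beta> * taylor_coeff f 0 = \<alpha> * taylor_coeff f 1"
      by (metis LIMSEQ_unique)
    then have "f \<in> ?V"
      using f by (simp add: constraint_space_def)
    then show "\<exists>f\<in>?V. \<forall>\<epsilon>>0. \<exists>N. \<forall>n\<ge>N. hnorm H2_ip (\<sigma> n - f) < \<epsilon>"
      using f by blast
  qed
  then show ?thesis
    by (simp add: hilbert_space_on_def V.linear_subspace V.inner_product)
qed


section \<open>The analytic model\<close>

lemma power_series_function_add:
  assumes "square_summable a" "square_summable b"
  shows "power_series_function (\<lambda>n. a n + b n) = power_series_function a + power_series_function b"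
  using assms
  by (intro H2_eqI)
    (simp_all add: power_series_function_mem_H2 taylor_coeff_power_series_function
      square_summable_add H2.add_mem H2_taylor_coeff_add)

lemma power_series_function_scale:
  assumes "square_summable a"
  shows "power_series_function (\<lambda>n. c * a n) = cscale c (power_series_function a)"
  using assms
  by (intro H2_eqI)
    (simp_all add: power_series_function_mem_H2 taylor_coeff_power_series_function
      square_summable_scale H2.scale_mem H2_taylor_coeff_scale)

lemma power_series_function_split:
  assumes "square_summable a" "w \<in> unit_disc"
  shows "power_series_function a w = a 0 + w * power_series_function (\<lambda>n. a (n + 1)) w"
proof -
  have s: "summable (\<lambda>n. a n * w ^ n)" "summable (\<lambda>n. a (n + 1) * w ^ n)"
    using power_series_square_summable(1) assms square_summable_shift[of a 1] by blast+
  have "(\<Sum>n. a n * w ^ n) = a 0 + (\<Sum>n. w * (a (n + 1) * w ^ n))"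
    using suminf_split_head[OF s(1)] by (simp add: algebra_simps)
  also have "\<dots> = a 0 + w * (\<Sum>n. a (n + 1) * w ^ n)"
    by (simp only: suminf_mult[OF s(2)])
  finally show ?thesis
    using assms(2) by (simp add: power_series_function_def zero_ext_def)
qed

text \<open>
  The pairing of \<open>f\<close> with the eigenvector of the adjoint of \<open>S\<close> for the eigenvalue \<open>cnj w\<close>, whose
  coordinates in the orthonormal basis \<open>\<alpha> + \<beta>z, z\<^sup>2, z\<^sup>3, \<dots>\<close> are the conjugates of
  \<open>1, (w - a)/\<beta>, (w - a) w/\<beta>, (w - a) w\<^sup>2/\<beta>, \<dots>\<close> with \<open>a = \<alpha> cnj \<beta>\<close>. On the space \<open>H\<^sup>2\<^sub>\<alpha>\<^sub>,\<^sub>\<beta>\<close> the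
  coordinate of \<open>f\<close> along \<open>\<alpha> + \<beta>z\<close> is \<open>f\<^sub>0/\<alpha>\<close>.
\<close>

definition shift_model :: "complex \<Rightarrow> complex \<Rightarrow> cfun \<Rightarrow> cfun" where
  "shift_model \<alpha> \<beta> f = zero_ext unit_disc (\<lambda>w. taylor_coeff f 0 / \<alpha> +
     (w - \<alpha> * cnj \<beta>) / \<beta> * power_series_function (\<lambda>n. taylor_coeff f (n + 2)) w)"

lemma tail_square_summable: "f \<in> H2 \<Longrightarrow> square_summable (\<lambda>n. taylor_coeff f (n + k))"
  by (simp only: square_summable_shift H2_square_summable)

lemma linear_shift_model: "linear_map_on H2 (shift_model \<alpha> \<beta>)"
  unfolding linear_map_on_def
proof (intro conjI ballI allI)
  fix f g assume H: "f \<in> H2" "g \<in> H2"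
  show "shift_model \<alpha> \<beta> (f + g) = shift_model \<alpha> \<beta> f + shift_model \<alpha> \<beta> g"
    unfolding shift_model_def H2_taylor_coeff_add[OF H]
      power_series_function_add[OF tail_square_summable[OF H(1)] tail_square_summable[OF H(2)]]
    by (simp add: fun_eq_iff zero_ext_def add_divide_distrib distrib_left)
next
  fix c f assume H: "f \<in> H2"
  show "shift_model \<alpha> \<beta> (cscale c f) = cscale c (shift_model \<alpha> \<beta> f)"
    unfolding shift_model_def H2_taylor_coeff_scale[OF H]
      power_series_function_scale[OF tail_square_summable[OF H]]
    by (simp add: fun_eq_iff zero_ext_def cscale_def distrib_left)
qed

lemma shift_model_analytic:
  assumes "f \<in> H2"
  shows "shift_model \<alpha> \<beta> f \<in> analytic_functions unit_disc"
proof -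
  let ?g = "power_series_function (\<lambda>n. taylor_coeff f (n + 2))"
  have "?g holomorphic_on unit_disc"
    using H2_analytic[OF power_series_function_mem_H2[OF tail_square_summable[OF assms, of 2]]]
    by (simp add: analytic_functions_def analytic_imp_holomorphic)
  then have "(\<lambda>w. taylor_coeff f 0 / \<alpha> + (w - \<alpha> * cnj \<beta>) * inverse \<beta> * ?g w)
      holomorphic_on unit_disc"
    by (intro holomorphic_intros)
  then have "shift_model \<alpha> \<beta> f holomorphic_on unit_disc"
    by (rule holomorphic_transform) (simp add: shift_model_def zero_ext_def divide_inverse)
  then show ?thesis
    by (simp add: analytic_functions_def analytic_on_open) (simp add: shift_model_def zero_ext_def)
qed

lemma shift_model_evaluation_bounded:
  assumes w: "w \<in> unit_disc"
  shows "\<exists>C. \<forall>f\<in>H2. cmod (shift_model \<alpha> \<beta> f w) \<le> C * hnorm H2_ip f"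
proof (intro exI ballI)
  fix f assume f: "f \<in> H2"
  let ?n = "hnorm H2_ip f" and ?g = "power_series_function (\<lambda>n. taylor_coeff f (n + 2)) w"
  let ?b = "(w - \<alpha> * cnj \<beta>) / \<beta>"
  have s: "summable (\<lambda>n. (cmod (taylor_coeff f n))\<^sup>2)"
    using H2_square_summable[OF f] by (simp add: square_summable_def)
  have "(\<Sum>n. (cmod (taylor_coeff f (n + 2)))\<^sup>2) \<le> (\<Sum>n. (cmod (taylor_coeff f n))\<^sup>2)"
    using suminf_split_initial_segment[OF s, of 2]
      sum_nonneg[of "{..<2}" "\<lambda>n. (cmod (taylor_coeff f n))\<^sup>2"] by simp
  then have tail: "sqrt (\<Sum>n. (cmod (taylor_coeff f (n + 2)))\<^sup>2) \<le> ?n"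
    using f by (simp add: hnorm_H2)
  have "cmod ?g \<le> sqrt (\<Sum>n. (cmod (taylor_coeff f (n + 2)))\<^sup>2) / (1 - cmod w)"
    using power_series_square_summable(2)[OF tail_square_summable[OF f] w, of 2] w
    by (simp add: power_series_function_def zero_ext_def)
  also have "\<dots> \<le> ?n / (1 - cmod w)"
    using tail w by (intro divide_right_mono) auto
  finally have g: "cmod ?g \<le> ?n / (1 - cmod w)" .
  have "cmod (shift_model \<alpha> \<beta> f w) \<le> cmod (taylor_coeff f 0 / \<alpha>) + cmod (?b * ?g)"
    using w norm_triangle_ineq by (simp add: shift_model_def zero_ext_def)
  also have "\<dots> \<le> ?n / cmod \<alpha> + cmod ?b * (?n / (1 - cmod w))"
    unfolding norm_mult[of ?b] norm_divide[of "taylor_coeff f 0"]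
    by (intro add_mono mult_left_mono g divide_right_mono cmod_taylor_coeff_le f) auto
  also have "\<dots> = (1 / cmod \<alpha> + cmod ?b / (1 - cmod w)) * ?n"
    by (simp add: distrib_right)
  finally show "cmod (shift_model \<alpha> \<beta> f w) \<le> (1 / cmod \<alpha> + cmod ?b / (1 - cmod w)) * ?n" .
qed

text \<open>
  At \<open>a = \<alpha> cnj \<beta>\<close>, which has modulus at most \<open>1/2\<close>, the second summand vanishes and \<open>f\<^sub>0\<close> can be
  read off. Away from \<open>a\<close> the factor \<open>w - a\<close> can be cancelled; as \<open>a \<noteq> 0\<close>, this happens on a
  neighbourhood of 0, which determines the remaining power series.
\<close>

lemma inj_on_shift_model:
  assumes \<alpha>: "\<alpha> \<noteq> 0" and \<beta>: "\<beta> \<noteq> 0" and norm: "(cmod \<alpha>)\<^sup>2 + (cmod \<beta>)\<^sup>2 = 1"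
  shows "inj_on (shift_model \<alpha> \<beta>) (constraint_space \<alpha> \<beta>)"
proof (rule inj_onI)
  fix f g
  assume V: "f \<in> constraint_space \<alpha> \<beta>" "g \<in> constraint_space \<alpha> \<beta>"
    and eq: "shift_model \<alpha> \<beta> f = shift_model \<alpha> \<beta> g"
  let ?a = "\<alpha> * cnj \<beta>"
  let ?f = "\<lambda>n. taylor_coeff f (n + 2)" and ?g = "\<lambda>n. taylor_coeff g (n + 2)"
  have H: "f \<in> H2" "g \<in> H2"
    using V by (simp_all add: constraint_space_def)
  note sf = tail_square_summable[OF H(1), of 2] and sg = tail_square_summable[OF H(2), of 2]
  have "2 * cmod ?a \<le> (cmod \<alpha>)\<^sup>2 + (cmod \<beta>)\<^sup>2"
    using zero_le_power2[of "cmod \<alpha> - cmod \<beta>"] by (simp add: power2_diff norm_mult)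
  then have a: "?a \<in> unit_disc"
    using norm by simp
  have c0: "taylor_coeff f 0 = taylor_coeff g 0"
    using fun_cong[OF eq, of ?a] a \<alpha> by (simp add: shift_model_def zero_ext_def)
  have same: "power_series_function ?f w = power_series_function ?g w"
    if "w \<in> unit_disc" "w \<noteq> ?a" for w
    using fun_cong[OF eq, of w] that c0 \<beta> by (simp add: shift_model_def zero_ext_def)
  have "\<forall>\<^sub>F w in nhds 0. w \<in> unit_disc - {?a}"
    using \<alpha> \<beta> by (intro eventually_nhds_in_open open_delete) auto
  then have "\<forall>\<^sub>F w in nhds 0. (\<lambda>n. ?f n * w ^ n) sums power_series_function ?g w"
  proof eventually_elim
    case (elim w)
    then show ?case
      using analytic_functions_sums[OF H2_analytic[OF power_series_function_mem_H2[OF sf]], of w]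
        same[of w] elim
      unfolding taylor_coeff_power_series_function[OF sf] by simp
  qed
  then have "taylor_coeff (power_series_function ?g) = ?f"
    by (rule taylor_coeff_eqI)
  then have tail: "taylor_coeff f (n + 2) = taylor_coeff g (n + 2)" for n
    unfolding taylor_coeff_power_series_function[OF sg] by (metis (no_types))
  have c1: "taylor_coeff f 1 = taylor_coeff g 1"
    using V c0 \<alpha> by (simp add: constraint_space_def)
  show "f = g"
  proof (rule H2_eqI[OF H])
    fix n :: nat
    consider "n = 0" | "n = 1" | "n \<ge> 2"
      by linarith
    then show "taylor_coeff f n = taylor_coeff g n"
    proof cases
      case 3
      then show ?thesis
        using tail[of "n - 2"] by (simp only: le_add_diff_inverse2)
    qed (simp_all only: c0 c1)
  qed
qed

text \<open>
  Shifting the tail of the series brings in the coefficient \<open>f\<^sub>1 = \<beta> f\<^sub>0/\<alpha>\<close>, and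
  \<open>a f\<^sub>0/\<alpha> + ((w - a)/\<beta>) f\<^sub>1 = w f\<^sub>0/\<alpha>\<close> supplies exactly the missing factor \<open>w\<close> in front of the
  constant term.
\<close>

lemma shift_model_intertwines:
  assumes f: "f \<in> constraint_space \<alpha> \<beta>"
    and \<alpha>: "\<alpha> \<noteq> 0" and \<beta>: "\<beta> \<noteq> 0" and norm: "(cmod \<alpha>)\<^sup>2 + (cmod \<beta>)\<^sup>2 = 1"
  shows "shift_model \<alpha> \<beta> (S_ab \<alpha> \<beta> f) = Mz (shift_model \<alpha> \<beta> f)"
proof
  fix w
  show "shift_model \<alpha> \<beta> (S_ab \<alpha> \<beta> f) w = Mz (shift_model \<alpha> \<beta> f) w"
  proof (cases "w \<in> unit_disc")
    case True
    have fH: "f \<in> H2" and f1: "taylor_coeff f 1 = \<beta> * taylor_coeff f 0 / \<alpha>"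
      using f \<alpha> by (simp_all add: constraint_space_def field_simps)
    let ?g = "power_series_function (\<lambda>n. taylor_coeff f (n + 2)) w"
    have "(\<lambda>n. compressed_shift_coeff \<alpha> \<beta> (taylor_coeff f) (n + 2)) = (\<lambda>n. taylor_coeff f (n + 1))"
      by (simp add: compressed_shift_coeff_def)
    moreover have "power_series_function (\<lambda>n. taylor_coeff f (n + 1)) w =
        taylor_coeff f 1 + w * ?g"
      using power_series_function_split[OF tail_square_summable[OF fH, of 1] True]
      by simp
    ultimately have "shift_model \<alpha> \<beta> (S_ab \<alpha> \<beta> f) w =
        \<alpha> * cnj \<beta> * taylor_coeff f 0 / \<alpha> + (w - \<alpha> * cnj \<beta>) / \<beta> * (taylor_coeff f 1 + w * ?g)"
      using True
      by (simp only: shift_model_def zero_ext_def taylor_coeff_S_ab[OF f \<alpha> norm] if_True)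
        (simp add: compressed_shift_coeff_def)
    also have "\<dots> = w * (taylor_coeff f 0 / \<alpha> + (w - \<alpha> * cnj \<beta>) / \<beta> * ?g)"
      unfolding f1 using \<alpha> \<beta> by (simp add: field_simps)
    also have "\<dots> = Mz (shift_model \<alpha> \<beta> f) w"
      using True by (simp add: Mz_def shift_model_def zero_ext_def)
    finally show ?thesis .
  qed (simp add: Mz_def shift_model_def zero_ext_def)
qed

theorem theorem2p4:
  fixes \<alpha> \<beta> :: complex
  assumes "\<alpha> \<noteq> 0" and "\<beta> \<noteq> 0" and "(cmod \<alpha>)\<^sup>2 + (cmod \<beta>)\<^sup>2 = 1"
  shows "is_shift (H2_ab \<alpha> \<beta>) H2_ip (S_ab \<alpha> \<beta>)"
  unfolding H2_ab_eq[OF assms(1)]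
proof (rule is_shiftI[where U = "shift_model \<alpha> \<beta>" and \<Omega> = unit_disc])
  let ?V = "constraint_space \<alpha> \<beta>"
  have VH: "f \<in> H2" if "f \<in> ?V" for f
    using that by (simp add: constraint_space_def)
  show "hilbert_space_on ?V H2_ip"
    by (rule constraint_space_hilbert)
  show "bounded_operator_on ?V H2_ip (S_ab \<alpha> \<beta>)"
    using assms by (intro bounded_S_ab)
  show "linear_map_on ?V (shift_model \<alpha> \<beta>)"
    using linear_shift_model VH unfolding linear_map_on_def by blast
  show "inj_on (shift_model \<alpha> \<beta>) ?V"
    using assms by (rule inj_on_shift_model)
  show "shift_model \<alpha> \<beta> f \<in> analytic_functions unit_disc" if "f \<in> ?V" for f
    using VH[OF that] by (rule shift_model_analytic)
  show "\<exists>C. \<forall>f\<in>?V. cmod (shift_model \<alpha> \<beta> f w) \<le> C * hnorm H2_ip f" if "w \<in> unit_disc" for w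
    using shift_model_evaluation_bounded[OF that] VH by blast
  show "shift_model \<alpha> \<beta> (S_ab \<alpha> \<beta> f) = Mz (shift_model \<alpha> \<beta> f)" if "f \<in> ?V" for f
    using that assms by (rule shift_model_intertwines)
qed auto

end
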